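(* Let $n$ be a power of two and let $d = 3n$. Then there exists a labeling $\gamma : [n]\times[n] \to \mathbb{F}_2^{d}$ which is simple cycle free.
   Context: $[n]=\{1,\ldots,n\}$. The complete bipartite graph $K_{n,n}$ has two disjoint vertex classes, each a copy of $[n]$, and its edges are identified with the pairs $(x,y)\in[n]\times[n]$ ($x$ in the first class, $y$ in the second). A function $\gamma:[n]\times[n]\to\mathbb{F}_2^d$ is thus a labeling of the edges of $K_{n,n}$. The labeling $\gamma$ is called simple cycle free if for every simple cycle $C$ in $K_{n,n}$ (a closed walk with no repeated vertices, of length $2k$ with $k\ge 2$) one has $\sum_{e\in C}\gamma(e)\neq 0$ in $\mathbb{F}_2^d$, the sum being over the edges of $C$. *)

theory Defs
  imports "HOL-Library.Z2" "Jordan_Normal_Form.Matrix" "Graph_Theory.Graph_Theory"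
begin

text \<open>
  The two vertex classes are the two summands of \<^typ>\<open>nat + nat\<close>. As usual in
  \<^theory>\<open>Graph_Theory.Digraph\<close>, an undirected graph is a symmetric digraph: every edge
  is represented by a pair of opposite arcs.
\<close>

definition complete_bipartite :: "nat \<Rightarrow> (nat + nat) pair_pre_digraph" where
  "complete_bipartite n =
     \<lparr> pverts = Inl ` {1..n} \<union> Inr ` {1..n},
       parcs = Inl ` {1..n} \<times> Inr ` {1..n} \<union> Inr ` {1..n} \<times> Inl ` {1..n} \<rparr>"

lemma complete_bipartite_digraph:
  "complete_bipartite_digraph n n (with_proj (complete_bipartite n))"
proof -
  have "card (Inl ` {1..n} :: (nat + nat) set) = n" "card (Inr ` {1..n} :: (nat + nat) set) = n"
    by (simp_all add: card_image)
  then show ?thesis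
    unfolding complete_bipartite_digraph_pair_def
    by (intro conjI exI[of _ "Inl ` {1..n}"] exI[of _ "Inr ` {1..n}"])
       (auto simp: complete_bipartite_def)
qed

text \<open>The edge \<open>(x, y)\<close> underlying an arc, whichever way the arc is traversed.\<close>

fun arc_edge :: "(nat + nat) \<times> (nat + nat) \<Rightarrow> nat \<times> nat" where
  "arc_edge (Inl x, Inr y) = (x, y)"
| "arc_edge (Inr y, Inl x) = (x, y)"
| "arc_edge _ = undefined"

text \<open>
  \<^const>\<open>pre_digraph.cycle\<close> asks for a nonempty closed walk without repeated vertices
  (apart from the end points), given by its list of arcs. In the symmetric digraph this still
  allows an edge to be traversed back and forth; the bound on the length excludes exactly
  these 2-cycles, since closed walks in a bipartite graph have even length.
\<close>

definition simple_cycle :: "nat \<Rightarrow> ((nat + nat) \<times> (nat + nat)) list \<Rightarrow> bool" where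
  "simple_cycle n C \<longleftrightarrow>
     pre_digraph.cycle (with_proj (complete_bipartite n)) C \<and> length C \<ge> 4"

text \<open>
  A labeling of the edges with values in the space of vectors of dimension \<open>d\<close> over the
  two-element field \<^typ>\<open>bit\<close>; its values outside \<open>[n] \<times> [n]\<close> are irrelevant.
\<close>

definition labeling :: "nat \<Rightarrow> nat \<Rightarrow> (nat \<times> nat \<Rightarrow> bit vec) \<Rightarrow> bool" where
  "labeling n d \<gamma> \<longleftrightarrow> \<gamma> \<in> {1..n} \<times> {1..n} \<rightarrow> carrier_vec d"

definition simple_cycle_free :: "nat \<Rightarrow> nat \<Rightarrow> (nat \<times> nat \<Rightarrow> bit vec) \<Rightarrow> bool" where
  "simple_cycle_free n d \<gamma> \<longleftrightarrow>
     (\<forall>C. simple_cycle n C \<longrightarrow>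
        finsum_vec TYPE(bit) d \<gamma> (arc_edge ` set C) \<noteq> 0\<^sub>v d)"

end

theory Submission
  imports Defs
begin

text \<open>
  Split one vertex class in two halves and spend one new coordinate on every vertex \<open>x\<close> of the
  other class, recording whether the edge at \<open>x\<close> leads to the second half. If these coordinates
  sum to zero over a cycle, the two cycle edges at each \<open>x\<close> lead to the same half, so by
  connectedness the cycle lives in a single half, and both halves can share one labeling of the
  smaller graph. Halving both classes of \<open>K\<^bsub>2m,2m\<^esub>\<close> in turn costs \<open>2m + m\<close> coordinates, and
  these costs add up to less than \<open>3n\<close>.
\<close>

section \<open>Edge sets of simple cycles, without order or orientation\<close>

text \<open>Describes a simple cycle as a finite, connected, 2-regular bipartite graph given by its
  edges. Connectedness says that no proper nonempty set of edges is closed under sharing an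
  endpoint. No traversal has to be carried along when vertices are relabeled or the classes
  exchanged.\<close>

definition polygon :: "('a \<times> 'b) set \<Rightarrow> bool" where
  "polygon E \<longleftrightarrow> finite E \<and> E \<noteq> {} \<and>
     (\<forall>x. card {e \<in> E. fst e = x} \<in> {0, 2}) \<and>
     (\<forall>y. card {e \<in> E. snd e = y} \<in> {0, 2}) \<and>
     (\<forall>A \<subseteq> E. A \<noteq> {} \<longrightarrow>
        (\<forall>e \<in> A. \<forall>f \<in> E. fst e = fst f \<or> snd e = snd f \<longrightarrow> f \<in> A) \<longrightarrow> A = E)"

lemma polygonI:
  assumes "finite E" "E \<noteq> {}"
    and "\<And>x. card {e \<in> E. fst e = x} \<in> {0, 2}"
    and "\<And>y. card {e \<in> E. snd e = y} \<in> {0, 2}"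
    and "\<And>A. A \<subseteq> E \<Longrightarrow> A \<noteq> {} \<Longrightarrow>
           (\<And>e f. e \<in> A \<Longrightarrow> f \<in> E \<Longrightarrow> fst e = fst f \<or> snd e = snd f \<Longrightarrow> f \<in> A) \<Longrightarrow> A = E"
  shows "polygon E"
  unfolding polygon_def
proof (intro conjI allI impI)
  fix A assume "A \<subseteq> E" "A \<noteq> {}"
    and "\<forall>e\<in>A. \<forall>f\<in>E. fst e = fst f \<or> snd e = snd f \<longrightarrow> f \<in> A"
  then show "A = E" by (intro assms(5)) metis+
qed (fact assms(1-4))+

lemma
  assumes "polygon E"
  shows polygon_finite: "finite E"
    and polygon_nonempty: "E \<noteq> {}"
    and polygon_card_fst: "card {e \<in> E. fst e = x} \<in> {0, 2}"
    and polygon_card_snd: "card {e \<in> E. snd e = y} \<in> {0, 2}"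
proof -
  note P = assms[unfolded polygon_def]
  show "finite E" by (rule P[THEN conjunct1])
  show "E \<noteq> {}" by (rule P[THEN conjunct2, THEN conjunct1])
  show "card {e \<in> E. fst e = x} \<in> {0, 2}"
    by (rule P[THEN conjunct2, THEN conjunct2, THEN conjunct1, THEN spec])
  show "card {e \<in> E. snd e = y} \<in> {0, 2}"
    by (rule P[THEN conjunct2, THEN conjunct2, THEN conjunct2, THEN conjunct1, THEN spec])
qed

text \<open>Serves as an induction principle: a property that holds at one edge and passes to
  adjacent edges holds on all of \<open>E\<close>; take for \<open>A\<close> the edges that have
  it.\<close>

lemma polygon_connected:
  assumes "polygon E" "A \<subseteq> E" "A \<noteq> {}"
    and "\<And>e f. e \<in> A \<Longrightarrow> f \<in> E \<Longrightarrow> fst e = fst f \<or> snd e = snd f \<Longrightarrow> f \<in> A"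
  shows "A = E"
proof -
  note P = assms(1)[unfolded polygon_def,
      THEN conjunct2, THEN conjunct2, THEN conjunct2, THEN conjunct2]
  show ?thesis
    by (rule P[THEN spec, THEN mp, OF assms(2), THEN mp, OF assms(3), THEN mp])
      (intro ballI impI, rule assms(4))
qed

text \<open>A fibre of \<open>q\<close> on the image is either empty, whence
  \<open>0 \<in> C\<close>, or the injective image of a fibre of \<open>p\<close>. Vertex degrees
  thus survive relabeling and exchange of the classes.\<close>

lemma card_fibre_image:
  assumes "inj_on \<phi> E"
    and "\<And>e f. e \<in> E \<Longrightarrow> f \<in> E \<Longrightarrow> q (\<phi> e) = q (\<phi> f) \<longleftrightarrow> p e = p f"
    and "\<And>x. card {e \<in> E. p e = x} \<in> C" "0 \<in> C"
  shows "card {e \<in> \<phi> ` E. q e = z} \<in> C"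
proof (cases "\<exists>e0 \<in> E. q (\<phi> e0) = z")
  case True
  then obtain e0 where e0: "e0 \<in> E" "q (\<phi> e0) = z" by blast
  have "{e \<in> \<phi> ` E. q e = z} = \<phi> ` {e \<in> E. p e = p e0}"
    using assms(2)[OF _ e0(1)] e0(2) by auto
  moreover have "inj_on \<phi> {e \<in> E. p e = p e0}"
    using assms(1) by (auto simp: inj_on_def)
  ultimately show ?thesis using assms(3) by (simp add: card_image)
next
  case False
  then have "{e \<in> \<phi> ` E. q e = z} = {}" by blast
  then show ?thesis using assms(4) by (metis card.empty)
qed

text \<open>Injectivity on the vertices that occur in \<open>E\<close> makes incidence the same
  before and after relabeling. Asking for no more admits maps such as reduction modulo
  \<open>b\<close>.\<close>

lemma polygon_image:
  assumes E: "polygon E" and f: "inj_on f (fst ` E)" and g: "inj_on g (snd ` E)"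
  shows "inj_on (map_prod f g) E" "polygon (map_prod f g ` E)"
proof -
  let ?\<phi> = "map_prod f g"
  show inj: "inj_on ?\<phi> E"
    using f g by (force simp: inj_on_def)
  have fst_eq: "fst (?\<phi> e) = fst (?\<phi> e') \<longleftrightarrow> fst e = fst e'" if "e \<in> E" "e' \<in> E" for e e'
    using that inj_on_eq_iff[OF f] by simp
  have snd_eq: "snd (?\<phi> e) = snd (?\<phi> e') \<longleftrightarrow> snd e = snd e'" if "e \<in> E" "e' \<in> E" for e e'
    using that inj_on_eq_iff[OF g] by simp
  show "polygon (?\<phi> ` E)"
  proof (rule polygonI)
    fix A assume A: "A \<subseteq> ?\<phi> ` E" "A \<noteq> {}"
      and cl: "\<And>e f. e \<in> A \<Longrightarrow> f \<in> ?\<phi> ` E \<Longrightarrow> fst e = fst f \<or> snd e = snd f \<Longrightarrow> f \<in> A"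
    have "{e \<in> E. ?\<phi> e \<in> A} = E"
    proof (rule polygon_connected[OF E])
      fix e f assume "e \<in> {e \<in> E. ?\<phi> e \<in> A}" "f \<in> E" "fst e = fst f \<or> snd e = snd f"
      then show "f \<in> {e \<in> E. ?\<phi> e \<in> A}"
        using cl[of "?\<phi> e" "?\<phi> f"] by auto
    qed (use A in auto)
    then have "?\<phi> ` E \<subseteq> A" unfolding image_subset_iff by blast
    with A(1) show "A = ?\<phi> ` E" by (rule subset_antisym)
  next
    show "card {e \<in> ?\<phi> ` E. fst e = x} \<in> {0, 2}" for x
      by (rule card_fibre_image[where q = fst and p = fst, OF inj fst_eq])
        (simp_all add: polygon_card_fst[OF E, simplified])
    show "card {e \<in> ?\<phi> ` E. snd e = y} \<in> {0, 2}" for y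
      by (rule card_fibre_image[where q = snd and p = snd, OF inj snd_eq])
        (simp_all add: polygon_card_snd[OF E, simplified])
  qed (use polygon_finite[OF E] polygon_nonempty[OF E] in auto)
qed

lemma polygon_swap:
  assumes E: "polygon E"
  shows "polygon (prod.swap ` E)"
proof (rule polygonI)
  fix A assume A: "A \<subseteq> prod.swap ` E" "A \<noteq> {}"
    and cl: "\<And>e f. e \<in> A \<Longrightarrow> f \<in> prod.swap ` E \<Longrightarrow> fst e = fst f \<or> snd e = snd f \<Longrightarrow> f \<in> A"
  have "{e \<in> E. prod.swap e \<in> A} = E"
  proof (rule polygon_connected[OF E])
    fix e f assume "e \<in> {e \<in> E. prod.swap e \<in> A}" "f \<in> E" "fst e = fst f \<or> snd e = snd f"
    then show "f \<in> {e \<in> E. prod.swap e \<in> A}"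
      using cl[of "prod.swap e" "prod.swap f"] by auto
  qed (use A in auto)
  then show "A = prod.swap ` E" using A by blast
next
  have inj: "inj_on prod.swap E" by (auto simp: inj_on_def)
  show "card {e \<in> prod.swap ` E. fst e = x} \<in> {0, 2}" for x
    by (rule card_fibre_image[OF inj _ polygon_card_snd[OF E]]) auto
  show "card {e \<in> prod.swap ` E. snd e = y} \<in> {0, 2}" for y
    by (rule card_fibre_image[OF inj _ polygon_card_fst[OF E]]) auto
qed (use polygon_finite[OF E] polygon_nonempty[OF E] in auto)

section \<open>Doubling the vertex classes\<close>

text \<open>Labels are coordinate functions of which only the first \<open>d\<close> values count,
  so coordinates are appended by a case distinction. The class sizes are separate because they are
  doubled one at a time, and vertices start at 0 to suit \<open>mod\<close>.\<close>

definition polygon_free :: "nat \<Rightarrow> nat \<Rightarrow> nat \<Rightarrow> (nat \<times> nat \<Rightarrow> nat \<Rightarrow> bit) \<Rightarrow> bool" where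
  "polygon_free a b d \<gamma> \<longleftrightarrow>
     (\<forall>E. polygon E \<longrightarrow> E \<subseteq> {..<a} \<times> {..<b} \<longrightarrow> (\<exists>i<d. (\<Sum>e\<in>E. \<gamma> e i) \<noteq> 0))"

lemma polygon_free_swap:
  assumes "polygon_free a b d \<gamma>"
  shows "polygon_free b a d (\<gamma> \<circ> prod.swap)"
  unfolding polygon_free_def
proof (intro allI impI)
  fix E :: "(nat \<times> nat) set" assume E: "polygon E" "E \<subseteq> {..<b} \<times> {..<a}"
  have "prod.swap ` E \<subseteq> {..<a} \<times> {..<b}" using E(2) by auto
  then obtain i where "i < d" "(\<Sum>e\<in>prod.swap ` E. \<gamma> e i) \<noteq> 0"
    using assms polygon_swap[OF E(1)] unfolding polygon_free_def by blast
  moreover have "(\<Sum>e\<in>prod.swap ` E. \<gamma> e i) = (\<Sum>e\<in>E. (\<gamma> \<circ> prod.swap) e i)"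
    by (subst sum.reindex) simp_all
  ultimately show "\<exists>i<d. (\<Sum>e\<in>E. (\<gamma> \<circ> prod.swap) e i) \<noteq> 0" by metis
qed

text \<open>Exactly two edges meet at \<open>fst f\<close>. If \<open>P\<close> held at
  \<open>e\<close> and failed at \<open>f\<close>, exactly one of them would be counted and the sum
  would be 1.\<close>

lemma polygon_parity_constant:
  assumes E: "polygon E" and "e \<in> E" "f \<in> E" "fst e = fst f" "P e"
    and zero: "(\<Sum>e\<in>E. of_bool (fst e = fst f \<and> P e) :: bit) = 0"
  shows "P f"
proof (rule ccontr)
  assume "\<not> P f"
  let ?A = "{e \<in> E. fst e = fst f \<and> P e}" and ?B = "{e \<in> E. fst e = fst f}"
  have fin: "finite ?B" using polygon_finite[OF E] by simp
  have "?A \<subset> ?B" using assms(3) \<open>\<not> P f\<close> by auto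
  then have "card ?A < card ?B" using fin by (rule psubset_card_mono[rotated])
  moreover have "card ?A \<noteq> 0"
  proof -
    have "e \<in> ?A" "finite ?A" using assms polygon_finite[OF E] by simp_all
    then show ?thesis by (metis card_0_eq empty_iff)
  qed
  moreover have "card ?B = 0 \<or> card ?B = 2"
    using polygon_card_fst[OF E, of "fst f"] by blast
  ultimately have "card ?A = 1" by linarith
  moreover have "(\<Sum>e\<in>E. of_bool (fst e = fst f \<and> P e) :: bit) = of_nat (card ?A)"
    using polygon_finite[OF E] by (simp add: sum.If_cases of_bool_def Int_def)
  ultimately show False using zero by simp
qed

lemma polygon_free_double:
  assumes \<gamma>: "polygon_free a b d \<gamma>"
  shows "\<exists>\<gamma>'. polygon_free a (2 * b) (d + a) \<gamma>'"
proof
  \<comment> \<open>Both halves share \<open>\<gamma>\<close> through reduction modulo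
    \<open>b\<close>; coordinate \<open>d + x\<close> is the new one of the vertex
    \<open>x < a\<close>.\<close>
  let ?\<gamma>' = "\<lambda>e i. if i < d then \<gamma> (fst e, snd e mod b) i
                   else of_bool (fst e = i - d \<and> b \<le> snd e)"
  show "polygon_free a (2 * b) (d + a) ?\<gamma>'"
    unfolding polygon_free_def
  proof (intro allI impI, rule ccontr)
    fix E :: "(nat \<times> nat) set"
    assume E: "polygon E" and sub: "E \<subseteq> {..<a} \<times> {..<2 * b}"
      and "\<not> (\<exists>i<d + a. (\<Sum>e\<in>E. ?\<gamma>' e i) \<noteq> 0)"
    then have zero: "\<And>i. i < d + a \<Longrightarrow> (\<Sum>e\<in>E. ?\<gamma>' e i) = 0" by blast
    let ?A = "{e \<in> E. b \<le> snd e}"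
    \<comment> \<open>\<open>?A\<close> is closed under adjacency: across a common first endpoint by
      parity, across a common second endpoint because the half is read off there.\<close>
    have "?A = E" if "?A \<noteq> {}"
    proof (rule polygon_connected[OF E _ that])
      fix e f assume e: "e \<in> ?A" and f: "f \<in> E" and ef: "fst e = fst f \<or> snd e = snd f"
      have "d + fst f < d + a" using sub f by auto
      from zero[OF this] have z: "(\<Sum>e\<in>E. of_bool (fst e = fst f \<and> b \<le> snd e) :: bit) = 0"
        by simp
      show "f \<in> ?A"
        using ef
      proof
        assume "fst e = fst f"
        with polygon_parity_constant[OF E _ f _ _ z, of e] e f show ?thesis by simp
      qed (use e f in simp)
    qed auto
    then have halves: "(\<forall>y \<in> snd ` E. y < b) \<or> (\<forall>y \<in> snd ` E. b \<le> y)"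
      by (metis (mono_tags, lifting) empty_Collect_eq imageE mem_Collect_eq not_le)
    have "inj_on (\<lambda>y. y mod b) (snd ` E)"
      using halves
    proof
      assume "\<forall>y \<in> snd ` E. y < b"
      then show ?thesis by (intro inj_onI) (metis mod_less)
    next
      assume ge: "\<forall>y \<in> snd ` E. b \<le> y"
      have "y mod b = y - b" if "y \<in> snd ` E" for y
      proof -
        have "y < 2 * b" using sub that by force
        moreover have "b \<le> y" using ge that by blast
        ultimately show ?thesis by (simp add: le_mod_geq)
      qed
      then show ?thesis using ge by (intro inj_onI) (metis eq_diff_iff)
    qed
    note im = polygon_image[OF E inj_on_id this]
    have "map_prod id (\<lambda>y. y mod b) ` E \<subseteq> {..<a} \<times> {..<b}"
    proof -
      \<comment> \<open>An edge of \<open>E\<close> forces \<open>2 * b > 0\<close>; without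
        \<open>b > 0\<close> the residues would not lie below \<open>b\<close>.\<close>
      have "b > 0" using sub polygon_nonempty[OF E] by (cases b) auto
      then show ?thesis using sub by auto
    qed
    then obtain i where i: "i < d" "(\<Sum>e\<in>map_prod id (\<lambda>y. y mod b) ` E. \<gamma> e i) \<noteq> 0"
      using \<gamma> im(2) unfolding polygon_free_def by blast
    have "(\<Sum>e\<in>map_prod id (\<lambda>y. y mod b) ` E. \<gamma> e i) = (\<Sum>e\<in>E. ?\<gamma>' e i)"
      using i(1) by (subst sum.reindex[OF im(1)]) (simp add: map_prod_def case_prod_unfold)
    also have "\<dots> = 0" using i(1) by (intro zero) simp
    finally show False using i(2) by contradiction
  qed
qed

text \<open>The only possible edge would have endpoints of degree 1, so there is no polygon at
  all.\<close>

lemma polygon_free_single: "polygon_free 1 1 d \<gamma>"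
  unfolding polygon_free_def
proof (intro allI impI)
  fix E :: "(nat \<times> nat) set" assume E: "polygon E" "E \<subseteq> {..<1} \<times> {..<1}"
  then have "E = {(0, 0)}" using polygon_nonempty[OF E(1)] by auto
  then have "{e \<in> E. fst e = 0} = {(0, 0)}" by auto
  then show "\<exists>i<d. (\<Sum>e\<in>E. \<gamma> e i) \<noteq> 0"
    using polygon_card_fst[OF E(1), of 0] by simp
qed

lemma polygon_free_power_of_two:
  "\<exists>\<gamma>. polygon_free (2 ^ k) (2 ^ k) (3 * 2 ^ k) \<gamma>"
proof (induction k)
  case 0
  then show ?case using polygon_free_single by auto
next
  case (Suc k)
  let ?m = "2 ^ k :: nat"
  obtain \<gamma> where "polygon_free ?m ?m (3 * ?m) \<gamma>" using Suc by blast
  then obtain \<gamma>1 where "polygon_free ?m (2 * ?m) (3 * ?m + ?m) \<gamma>1"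
    using polygon_free_double by blast
  \<comment> \<open>After the swap the undoubled class has size \<open>2 * ?m\<close>, which is the
    cost of this doubling. In total \<open>3 * ?m + ?m + 2 * ?m = 3 * (2 * ?m)\<close>, so the
    factor 3 is reproduced.\<close>
  from polygon_free_double[OF polygon_free_swap[OF this]]
  show ?case by (simp add: algebra_simps)
qed

section \<open>Arcs of a directed cycle\<close>

context pre_digraph
begin

text \<open>Membership in \<open>A\<close> propagates along the walk, since an arc in
  \<open>A\<close> brings in all arcs of \<open>S\<close> that leave its head. \<open>S\<close>
  stays fixed while the walk shrinks in the induction; the second conjunct allows the propagation to
  continue beyond \<open>w\<close>.\<close>

lemma cas_closed_set:
  assumes "cas u p w" "set p \<subseteq> S"
    and "\<And>a b. a \<in> A \<Longrightarrow> b \<in> S \<Longrightarrow> head G a = tail G b \<Longrightarrow> b \<in> A"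
    and "\<And>b. b \<in> S \<Longrightarrow> tail G b = u \<Longrightarrow> b \<in> A"
  shows "set p \<subseteq> A \<and> (\<forall>b \<in> S. tail G b = w \<longrightarrow> b \<in> A)"
  using assms
proof (induction u p w rule: cas.induct)
  case (2 u e es v)
  have e: "tail G e = u" "cas (head G e) es v" "e \<in> S" "set es \<subseteq> S"
    using 2(2,3) by simp_all
  have "e \<in> A" using e by (intro 2(5)) simp_all
  moreover have "set es \<subseteq> A \<and> (\<forall>b \<in> S. tail G b = v \<longrightarrow> b \<in> A)"
    using e \<open>e \<in> A\<close> 2(4) by (intro 2(1)) metis+
  ultimately show ?case by simp
qed simp

lemma closed_cas_strongly_connected:
  assumes "cas u p u" "A \<subseteq> set p" "A \<noteq> {}"
    and cl: "\<And>a b. a \<in> A \<Longrightarrow> b \<in> set p \<Longrightarrow> head G a = tail G b \<Longrightarrow> b \<in> A"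
  shows "A = set p"
proof -
  obtain a where a: "a \<in> A" "a \<in> set p" using assms by blast
  then obtain q r where p: "p = q @ a # r" by (meson split_list)
  \<comment> \<open>First follow the remainder \<open>r\<close> of the walk from \<open>a\<close> to
    the base point \<open>u\<close>, then run once through all of \<open>p\<close> from
    there.\<close>
  have "cas (head G a) r u" using assms(1) p by (auto simp: cas_append_iff)
  moreover have "set r \<subseteq> set p" using p by auto
  ultimately have start: "\<forall>b \<in> set p. tail G b = u \<longrightarrow> b \<in> A"
    by (rule cas_closed_set[THEN conjunct2]) (use cl a(1) in metis)+
  have "set p \<subseteq> A"
    by (rule cas_closed_set[OF assms(1) order_refl, THEN conjunct1]) (use cl start in metis)+
  with assms(2) show ?thesis by simp
qed

lemma cycle_arcs:
  assumes "cycle p"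
  shows "set p \<subseteq> arcs G" "p \<noteq> []" "distinct p"
    "inj_on (tail G) (set p)" "inj_on (head G) (set p)" "tail G ` set p = head G ` set p"
    "\<And>A. A \<subseteq> set p \<Longrightarrow> A \<noteq> {} \<Longrightarrow>
       (\<And>a b. a \<in> A \<Longrightarrow> b \<in> set p \<Longrightarrow> head G a = tail G b \<Longrightarrow> b \<in> A) \<Longrightarrow> A = set p"
proof -
  obtain u where u: "awalk u p u" "distinct (tl (awalk_verts u p))" "p \<noteq> []"
    using assms unfolding cycle_def by blast
  then have cas: "cas u p u" and "set p \<subseteq> arcs G" unfolding awalk_def by auto
  then show "set p \<subseteq> arcs G" "p \<noteq> []" using u by auto
  have verts: "awalk_verts u p = tail G (hd p) # map (head G) p"
    "awalk_verts u p = map (tail G) p @ [head G (last p)]"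
    using awalk_verts_conv'[OF cas] awalk_verts_conv[of u p] u(3) by auto
  have hd: "tail G (hd p) = u" using cas u(3) by (cases p) auto
  have last: "head G (last p) = u"
    using cas u(3) by (induction p arbitrary: u rule: rev_induct) (auto simp: cas_append_iff)
  have heads: "distinct (map (head G) p)" using u(2) verts(1) by simp
  then show "inj_on (head G) (set p)" "distinct p" by (auto simp: distinct_map)
  \<comment> \<open>The vertex sequence is read in two ways, as the start followed by all heads and
    as all tails followed by the end. Cancelling \<open>u\<close> shows that heads and tails agree
    as multisets, so distinctness passes from heads to tails.\<close>
  have rot: "u # map (head G) p = map (tail G) p @ [u]" using verts hd last by simp
  have "mset (map (head G) p) = mset (map (tail G) p)"
    using arg_cong[OF rot, of mset] by simp
  then show "inj_on (tail G) (set p)" "tail G ` set p = head G ` set p"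
    using heads by (metis distinct_map mset_eq_imp_distinct_iff, metis list.set_map mset_eq_setD)
  show "A = set p" if "A \<subseteq> set p" "A \<noteq> {}"
    "\<And>a b. a \<in> A \<Longrightarrow> b \<in> set p \<Longrightarrow> head G a = tail G b \<Longrightarrow> b \<in> A" for A
    by (rule closed_cas_strongly_connected[OF cas]) (use that in auto)
qed

end

section \<open>From simple cycles to polygons\<close>

text \<open>Each vertex on the cycle has one outgoing and one incoming arc. These give two different
  edges once no edge is traversed in both directions, which the length bound ensures.\<close>

lemma simple_cycle_polygon:
  assumes "simple_cycle n C"
  shows "polygon (arc_edge ` set C)" "arc_edge ` set C \<subseteq> {1..n} \<times> {1..n}"
proof -
  let ?S = "set C"
  have cyc: "pre_digraph.cycle (with_proj (complete_bipartite n)) C" and len: "length C \<ge> 4"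
    using assms by (auto simp: simple_cycle_def)
  note c = pre_digraph.cycle_arcs[OF cyc, simplified]
  have card_S: "card ?S \<ge> 4" using len c(3) by (simp add: distinct_card)
  have arcs: "\<exists>x\<in>{1..n}. \<exists>y\<in>{1..n}. a = (Inl x, Inr y) \<or> a = (Inr y, Inl x)" if "a \<in> ?S" for a
    using c(1) that by (auto simp: complete_bipartite_def)
  show "arc_edge ` ?S \<subseteq> {1..n} \<times> {1..n}" using arcs by fastforce
  \<comment> \<open>An arc and its reversal are closed under successors, so they would already be
    the whole cycle, which has at least four arcs.\<close>
  have no_reversal: "prod.swap a \<notin> ?S" if a: "a \<in> ?S" for a
  proof
    assume a': "prod.swap a \<in> ?S"
    have "{a, prod.swap a} = ?S"
    proof (rule c(7))
      fix x y assume "x \<in> {a, prod.swap a}" and y: "y \<in> ?S" "snd x = fst y"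
      then have "fst y = fst (prod.swap a) \<or> fst y = fst a" by auto
      then show "y \<in> {a, prod.swap a}" using a a' y(1) inj_onD[OF c(4)] by blast
    qed (use a a' in auto)
    moreover have "card {a, prod.swap a} \<le> 2" by (simp add: card_insert_if)
    ultimately have "card ?S \<le> 2" by simp
    with card_S show False by simp
  qed
  have inj: "inj_on arc_edge ?S"
  proof
    fix a b assume ab: "a \<in> ?S" "b \<in> ?S" "arc_edge a = arc_edge b"
    then have "a = b \<or> b = prod.swap a" using arcs[of a] arcs[of b] by auto
    with no_reversal ab show "a = b" by blast
  qed
  have card_incident: "card {a \<in> ?S. fst a = w \<or> snd a = w} \<in> {0, 2}" for w
  proof (cases "w \<in> fst ` ?S")
    case True
    then obtain a where a: "a \<in> ?S" "fst a = w" by auto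
    obtain b where b: "b \<in> ?S" "snd b = w" using True c(6) by auto
    have "{a \<in> ?S. fst a = w \<or> snd a = w} = {a, b}"
    proof -
      have "x = a" if "x \<in> ?S" "fst x = w" for x
        using that a inj_onD[OF c(4)] by metis
      moreover have "x = b" if "x \<in> ?S" "snd x = w" for x
        using that b inj_onD[OF c(5)] by metis
      ultimately show ?thesis using a b by blast
    qed
    \<comment> \<open>Equality would make the arc a loop at \<open>w\<close>, but arcs join
      different classes.\<close>
    moreover have "a \<noteq> b" using arcs[OF a(1)] a b by auto
    ultimately show ?thesis by simp
  next
    case False
    then have "w \<notin> fst ` ?S" "w \<notin> snd ` ?S" using c(6) by simp_all
    then have "{a \<in> ?S. fst a = w \<or> snd a = w} = {}" by blast
    then show ?thesis by (metis card.empty insertI1)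
  qed
  have card_edges: "card (arc_edge ` {a \<in> ?S. fst a = w \<or> snd a = w}) \<in> {0, 2}" for w
  proof -
    have "inj_on arc_edge {a \<in> ?S. fst a = w \<or> snd a = w}"
      using inj by (rule inj_on_subset) simp
    then show ?thesis using card_incident[of w] by (simp only: card_image)
  qed
  show "polygon (arc_edge ` ?S)"
  proof (rule polygonI)
    fix x
    have "fst (arc_edge a) = x \<longleftrightarrow> fst a = Inl x \<or> snd a = Inl x" if "a \<in> ?S" for a
      using arcs[OF that] by auto
    then have "{e \<in> arc_edge ` ?S. fst e = x} = arc_edge ` {a \<in> ?S. fst a = Inl x \<or> snd a = Inl x}"
      by blast
    then show "card {e \<in> arc_edge ` ?S. fst e = x} \<in> {0, 2}" by (simp only: card_edges)
  next
    fix y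
    have "snd (arc_edge a) = y \<longleftrightarrow> fst a = Inr y \<or> snd a = Inr y" if "a \<in> ?S" for a
      using arcs[OF that] by auto
    then have "{e \<in> arc_edge ` ?S. snd e = y} = arc_edge ` {a \<in> ?S. fst a = Inr y \<or> snd a = Inr y}"
      by blast
    then show "card {e \<in> arc_edge ` ?S. snd e = y} \<in> {0, 2}" by (simp only: card_edges)
  next
    fix A assume A: "A \<subseteq> arc_edge ` ?S" "A \<noteq> {}"
      and cl: "\<And>e f. e \<in> A \<Longrightarrow> f \<in> arc_edge ` ?S \<Longrightarrow> fst e = fst f \<or> snd e = snd f \<Longrightarrow> f \<in> A"
    \<comment> \<open>Consecutive arcs share a vertex, so their edges agree in a coordinate; closure
      of \<open>A\<close> under adjacency thus gives closure under successors.\<close>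
    have "{a \<in> ?S. arc_edge a \<in> A} = ?S"
    proof (rule c(7))
      fix a b assume ab: "a \<in> {a \<in> ?S. arc_edge a \<in> A}" "b \<in> ?S" "snd a = fst b"
      then have "fst (arc_edge a) = fst (arc_edge b) \<or> snd (arc_edge a) = snd (arc_edge b)"
        using arcs[of a] arcs[of b] by auto
      then show "b \<in> {a \<in> ?S. arc_edge a \<in> A}" using cl[of "arc_edge a" "arc_edge b"] ab by auto
    qed (use A in auto)
    then show "A = arc_edge ` ?S" using A by blast
  qed (use c(2) in auto)
qed

section \<open>Passage to vector labels and vertices numbered from 1\<close>

theorem theorem1p2:
  fixes n d :: nat
  assumes "\<exists>k::nat. n = 2 ^ k"
    and "d = 3 * n"
  shows "\<exists>\<gamma>. labeling n d \<gamma> \<and> simple_cycle_free n d \<gamma>"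
proof -
  obtain \<gamma> where \<gamma>: "polygon_free n n d \<gamma>"
    using assms polygon_free_power_of_two by blast
  \<comment> \<open>Shifts vertices from \<open>{1..n}\<close> to \<open>{..<n}\<close>; the
    truncated subtraction is injective there because all vertices are positive.\<close>
  let ?\<phi> = "map_prod (\<lambda>x. x - 1) (\<lambda>y. y - 1) :: nat \<times> nat \<Rightarrow> nat \<times> nat"
  let ?\<gamma>' = "\<lambda>e. vec d (\<gamma> (?\<phi> e))"
  have "simple_cycle_free n d ?\<gamma>'"
    unfolding simple_cycle_free_def
  proof (intro allI impI notI)
    fix C assume "simple_cycle n C"
      and zero: "finsum_vec TYPE(bit) d ?\<gamma>' (arc_edge ` set C) = 0\<^sub>v d"
    let ?E = "arc_edge ` set C"
    have E: "polygon ?E" and sub: "?E \<subseteq> {1..n} \<times> {1..n}"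
      using simple_cycle_polygon[OF \<open>simple_cycle n C\<close>] by auto
    have pos: "\<And>e. e \<in> ?E \<Longrightarrow> fst e \<ge> 1 \<and> snd e \<ge> 1" using sub by force
    have "inj_on (\<lambda>x. x - 1) (fst ` ?E)" "inj_on (\<lambda>x. x - 1) (snd ` ?E)"
      using pos by (auto intro!: inj_on_diff_nat)
    note im = polygon_image[OF E this]
    have "?\<phi> ` ?E \<subseteq> {..<n} \<times> {..<n}" using sub by fastforce
    then obtain i where i: "i < d" "(\<Sum>e\<in>?\<phi> ` ?E. \<gamma> e i) \<noteq> 0"
      using \<gamma> im(2) unfolding polygon_free_def by blast
    have "finsum_vec TYPE(bit) d ?\<gamma>' ?E $ i = (\<Sum>e\<in>?E. ?\<gamma>' e $ i)"
      using i by (intro index_finsum_vec) auto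
    also have "\<dots> = (\<Sum>e\<in>?\<phi> ` ?E. \<gamma> e i)"
      using i(1) by (subst sum.reindex[OF im(1)]) simp
    finally show False using zero i by simp
  qed
  moreover have "labeling n d ?\<gamma>'" by (auto simp: labeling_def)
  ultimately show ?thesis by blast
qed

end
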